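(* Let $\mathcal{B}=(\mathbf{e}_n)_{n=1}^\infty$ be a semi-normalized Schauder basis of an infinite-dimensional separable (real or complex) Banach space $\mathbb{X}$. Then $\mathcal{B}$ is $1$-almost greedy if and only if $\mathcal{B}$ has Property (A).
   Context: Setting: $(\mathbb{X},\Vert\cdot\Vert)$ is an infinite-dimensional separable real or complex Banach space with a Schauder basis $\mathcal{B}=(\mathbf{e}_n)_{n=1}^\infty$ and biorthogonal functionals $(\mathbf{e}_n^* )_{n=1}^\infty$, so that $x=\sum_{n=1}^\infty \mathbf{e}_n^*(x)\mathbf{e}_n$ uniquely for each $x\in\mathbb{X}$. Semi-normalized means $0<\inf_n\Vert \mathbf{e}_n\Vert\le\sup_n\Vert \mathbf{e}_n\Vert<\infty$. $\mathbb{N}=\{1,2,\dots\}$. $\operatorname{supp}(x)=\{n\in\mathbb{N}\colon \mathbf{e}_n^*(x)\neq 0\}$. For finite $A\subset\mathbb{N}$, $P_A(x)=\sum_{n\in A}\mathbf{e}_n^*(x)\mathbf{e}_n$. Greedy orderings: a greedy ordering for $x$ is an injective map $\rho\colon\mathbb{N}\to\mathbb{N}$ with $\operatorname{supp}(x)\subset\rho(\mathbb{N})$ and $|\mathbf{e}_{\rho(i)}^*(x)|\ge|\mathbf{e}_{\rho(j)}^*(x)|$ whenever $i\le j$. The natural greedy ordering for $x$ is the unique greedy ordering $\rho$ such that, for $i\le j$, $\rho(i)\le\rho(j)$ if $|\mathbf{e}_{\rho(i)}^*(x)|=|\mathbf{e}_{\rho(j)}^*(x)|$, and such that $\rho(\mathbb{N})=\mathbb{N}$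 if $x$ is finitely supported (if $x$ is infinitely supported then $\rho(\mathbb{N})=\operatorname{supp}(x)$). The $m$-th natural greedy approximation is $\mathcal{G}_m(x)=\sum_{i=1}^m\mathbf{e}_{\rho(i)}^*(x)\mathbf{e}_{\rho(i)}$ with $\rho$ the natural greedy ordering for $x$. $C$-almost greedy ($C\ge 1$): for all $x\in\mathbb{X}$ and $m\in\mathbb{N}$, $\Vert x-\mathcal{G}_m(x)\Vert\le C\inf\{\Vert x-P_A(x)\Vert\colon A\subset\mathbb{N},\ |A|=m\}$. Disjoint greedy permutation: $y$ is a disjoint greedy permutation of $x$ if $x=z+t\sum_{n\in A}\varepsilon_n\mathbf{e}_n$ and $y=z+t\sum_{n\in B}\theta_n\mathbf{e}_n$ for some $z\in\mathbb{X}$, some disjoint finite sets $A,B\subset\mathbb{N}$ with $|A|=|B|$ and $\operatorname{supp}(z)\cap(A\cup B)=\emptyset$, some signs (scalars of modulus one) $(\varepsilon_n)_{n\in A}$, $(\theta_n)_{n\in B}$, and some scalar $t$ with $\sup_n|\mathbf{e}_n^*(z)|\le t$. Property (A): $\Vert x\Vert=\Vert y\Vert$ whenever $y$ is a disjoint greedy permutation of $x$. *)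

theory Defs
  imports "HOL-Analysis.Analysis"
begin

text \<open>
  The real and the complex case are treated uniformly: the scalars form a complete normed field
  over the reals with multiplicative norm, which by Gelfand--Mazur is \<open>real\<close> or \<open>complex\<close> up to
  isometric isomorphism. Since the library has no class of complex Banach spaces, the scalar
  multiplication is an explicit parameter on top of the real Banach space structure; its
  restriction to real scalars is required to be the given real one.
\<close>

locale normed_vector_space = vector_space smul
  for smul :: "'k::{real_normed_field,banach} \<Rightarrow> 'a::real_normed_vector \<Rightarrow> 'a" +
  assumes norm_scale: "norm (smul c x) = norm c * norm x"
    and scale_of_real: "smul (of_real r) x = r *\<^sub>R x"

lemma normed_vector_space_scaleR:
  "normed_vector_space (scaleR :: real \<Rightarrow> 'a::real_normed_vector \<Rightarrow> 'a)"
  by unfold_locales (auto simp: algebra_simps)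

definition infinite_dimensional :: "('k::field \<Rightarrow> 'a::ab_group_add \<Rightarrow> 'a) \<Rightarrow> bool" where
  "infinite_dimensional smul \<longleftrightarrow> \<not> (\<exists>S. finite S \<and> module.span smul S = UNIV)"

text \<open>Bases are indexed by \<open>nat\<close> starting from \<open>0\<close>, in the usual order.\<close>

definition schauder_basis ::
    "('k::field \<Rightarrow> 'a::real_normed_vector \<Rightarrow> 'a) \<Rightarrow> (nat \<Rightarrow> 'a) \<Rightarrow> bool" where
  "schauder_basis smul e \<longleftrightarrow> (\<forall>x. \<exists>!a :: nat \<Rightarrow> 'k. (\<lambda>n. smul (a n) (e n)) sums x)"

text \<open>The biorthogonal functionals: \<open>coord smul e n x\<close> is the \<open>n\<close>-th coefficient of \<open>x\<close>.\<close>

definition coord ::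
    "('k::field \<Rightarrow> 'a::real_normed_vector \<Rightarrow> 'a) \<Rightarrow> (nat \<Rightarrow> 'a) \<Rightarrow> nat \<Rightarrow> 'a \<Rightarrow> 'k" where
  "coord smul e n x = (THE a :: nat \<Rightarrow> 'k. (\<lambda>n. smul (a n) (e n)) sums x) n"

definition semi_normalized :: "(nat \<Rightarrow> 'a::real_normed_vector) \<Rightarrow> bool" where
  "semi_normalized e \<longleftrightarrow> 0 < (INF n. norm (e n)) \<and> bdd_above (range (\<lambda>n. norm (e n)))"

definition supp ::
    "('k::field \<Rightarrow> 'a::real_normed_vector \<Rightarrow> 'a) \<Rightarrow> (nat \<Rightarrow> 'a) \<Rightarrow> 'a \<Rightarrow> nat set" where
  "supp smul e x = {n. coord smul e n x \<noteq> 0}"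

definition coord_proj ::
    "('k::field \<Rightarrow> 'a::real_normed_vector \<Rightarrow> 'a) \<Rightarrow> (nat \<Rightarrow> 'a) \<Rightarrow> nat set \<Rightarrow> 'a \<Rightarrow> 'a" where
  "coord_proj smul e A x = (\<Sum>n\<in>A. smul (coord smul e n x) (e n))"

definition greedy_ordering ::
    "('k::real_normed_field \<Rightarrow> 'a::real_normed_vector \<Rightarrow> 'a) \<Rightarrow> (nat \<Rightarrow> 'a) \<Rightarrow> 'a \<Rightarrow> (nat \<Rightarrow> nat) \<Rightarrow> bool"
where
  "greedy_ordering smul e x \<rho> \<longleftrightarrow>
     inj \<rho> \<and> supp smul e x \<subseteq> range \<rho> \<and>
     (\<forall>i j. i \<le> j \<longrightarrow> norm (coord smul e (\<rho> i) x) \<ge> norm (coord smul e (\<rho> j) x))"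

text \<open>
  For a semi-normalized Schauder basis there is exactly one such \<open>\<rho>\<close>. If \<open>x\<close> is infinitely
  supported, its range is automatically the support of \<open>x\<close>, because once a coordinate of
  modulus zero is listed all later ones vanish as well.
\<close>

definition is_natural_greedy_ordering ::
    "('k::real_normed_field \<Rightarrow> 'a::real_normed_vector \<Rightarrow> 'a) \<Rightarrow> (nat \<Rightarrow> 'a) \<Rightarrow> 'a \<Rightarrow> (nat \<Rightarrow> nat) \<Rightarrow> bool"
where
  "is_natural_greedy_ordering smul e x \<rho> \<longleftrightarrow>
     greedy_ordering smul e x \<rho> \<and>
     (\<forall>i j. i \<le> j \<longrightarrow> norm (coord smul e (\<rho> i) x) = norm (coord smul e (\<rho> j) x) \<longrightarrow> \<rho> i \<le> \<rho> j) \<and>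
     (finite (supp smul e x) \<longrightarrow> range \<rho> = UNIV)"

definition natural_greedy_ordering ::
    "('k::real_normed_field \<Rightarrow> 'a::real_normed_vector \<Rightarrow> 'a) \<Rightarrow> (nat \<Rightarrow> 'a) \<Rightarrow> 'a \<Rightarrow> nat \<Rightarrow> nat"
where
  "natural_greedy_ordering smul e x = (THE \<rho>. is_natural_greedy_ordering smul e x \<rho>)"

definition greedy_approx ::
    "('k::real_normed_field \<Rightarrow> 'a::real_normed_vector \<Rightarrow> 'a) \<Rightarrow> (nat \<Rightarrow> 'a) \<Rightarrow> nat \<Rightarrow> 'a \<Rightarrow> 'a"
where
  "greedy_approx smul e m x =
     (\<Sum>i<m. smul (coord smul e (natural_greedy_ordering smul e x i) x)
                   (e (natural_greedy_ordering smul e x i)))"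

definition almost_greedy ::
    "('k::real_normed_field \<Rightarrow> 'a::real_normed_vector \<Rightarrow> 'a) \<Rightarrow> (nat \<Rightarrow> 'a) \<Rightarrow> real \<Rightarrow> bool"
where
  "almost_greedy smul e C \<longleftrightarrow>
     (\<forall>x. \<forall>m\<ge>1. norm (x - greedy_approx smul e m x)
        \<le> C * Inf {norm (x - coord_proj smul e A x) | A. finite A \<and> card A = m})"

text \<open>
  The scalar \<open>t\<close> dominates \<open>sup\<^sub>n |e\<^sub>n\<^sup>*(z)|\<close>, so it is a (nonnegative) real number.
\<close>

definition disjoint_greedy_permutation ::
    "('k::real_normed_field \<Rightarrow> 'a::real_normed_vector \<Rightarrow> 'a) \<Rightarrow> (nat \<Rightarrow> 'a) \<Rightarrow> 'a \<Rightarrow> 'a \<Rightarrow> bool"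
where
  "disjoint_greedy_permutation smul e x y \<longleftrightarrow>
     (\<exists>z A B (\<epsilon> :: nat \<Rightarrow> 'k) (\<theta> :: nat \<Rightarrow> 'k) (t :: real).
        finite A \<and> finite B \<and> A \<inter> B = {} \<and> card A = card B \<and>
        supp smul e z \<inter> (A \<union> B) = {} \<and>
        (\<forall>n\<in>A. norm (\<epsilon> n) = 1) \<and> (\<forall>n\<in>B. norm (\<theta> n) = 1) \<and>
        (\<forall>n. norm (coord smul e n z) \<le> t) \<and>
        x = z + smul (of_real t) (\<Sum>n\<in>A. smul (\<epsilon> n) (e n)) \<and>
        y = z + smul (of_real t) (\<Sum>n\<in>B. smul (\<theta> n) (e n)))"

definition property_A ::
    "('k::real_normed_field \<Rightarrow> 'a::real_normed_vector \<Rightarrow> 'a) \<Rightarrow> (nat \<Rightarrow> 'a) \<Rightarrow> bool"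
where
  "property_A smul e \<longleftrightarrow>
     (\<forall>x y. disjoint_greedy_permutation smul e x y \<longrightarrow> norm x = norm y)"

end

theory Submission
  imports Defs
begin

text \<open>
  Write \<open>|x\<^sub>n|\<close> for the modulus of the \<open>n\<close>-th coordinate of \<open>x\<close>.

  Let the basis have Property (A). If \<open>w\<close> is finitely supported with coordinates of modulus at
  most \<open>t\<close>, and \<open>D\<close> is a finite set off its support, then the block \<open>t \<Sum>\<^sub>D \<epsilon>\<^sub>n e\<^sub>n\<close> may be moved to
  a fresh set and back with other signs, so that \<open>\<parallel>w + t \<Sum>\<^sub>D \<epsilon>\<^sub>n e\<^sub>n\<parallel>\<close> does not depend on the signs
  \<open>\<epsilon>\<close>. Since a scalar of modulus at most \<open>t\<close> lies on a segment between two opposite scalars of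
  modulus \<open>t\<close>, convexity shows that this common value bounds \<open>\<parallel>w + \<Sum>\<^sub>D a\<^sub>n e\<^sub>n\<parallel>\<close> whenever all
  \<open>|a\<^sub>n| \<le> t\<close> (\<open>norm_small_block_le_flat_block\<close>). The special case of \<open>a\<close> of constant modulus says
  that a flat block grows in norm with its height. Raising the height of a block step by step, and
  freezing at each step the coordinates that have reached their target, gives
  \<open>\<parallel>w + t \<Sum>\<^sub>E \<epsilon>\<^sub>n e\<^sub>n\<parallel> \<le> \<parallel>w + \<Sum>\<^sub>E b\<^sub>n e\<^sub>n\<parallel>\<close> whenever \<open>|b\<^sub>n| \<ge> t\<close> and \<open>b\<^sub>n = |b\<^sub>n| \<epsilon>\<^sub>n\<close>
  (\<open>norm_flat_block_le_large_block\<close>).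

  Now let \<open>G\<close> be a greedy set of \<open>x\<close>, let \<open>A\<close> have the same size, and let \<open>t\<close> be the minimum of
  \<open>|x\<^sub>n|\<close> on \<open>G\<close>. With \<open>w = x - P\<^bsub>A \<union> G\<^esub> x\<close>, \<open>D = A - G\<close> and \<open>E = G - A\<close> one has
  \<open>x - P\<^sub>G x = w + P\<^sub>D x\<close> and \<open>x - P\<^sub>A x = w + P\<^sub>E x\<close>, where \<open>|x\<^sub>n| \<le> t\<close> on \<open>D\<close> and \<open>|x\<^sub>n| \<ge> t\<close> on
  \<open>E\<close>. Passing through flat blocks of height \<open>t\<close> on \<open>D\<close> and on \<open>E\<close>, which Property (A) exchanges,
  yields \<open>\<parallel>x - P\<^sub>G x\<parallel> \<le> \<parallel>x - P\<^sub>A x\<parallel>\<close>; the tail \<open>w\<close> is reached as a limit of its partial sums, since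
  a fresh set need not exist for \<open>w\<close> itself.

  Conversely, given \<open>x = z + t \<Sum>\<^sub>A \<epsilon>\<^sub>n e\<^sub>n\<close> and \<open>y = z + t \<Sum>\<^sub>B \<theta>\<^sub>n e\<^sub>n\<close>, the vector
  \<open>z + (t + \<delta>) \<Sum>\<^sub>A \<epsilon>\<^sub>n e\<^sub>n + t \<Sum>\<^sub>B \<theta>\<^sub>n e\<^sub>n\<close> has \<open>A\<close> as its only greedy set of size \<open>card A\<close>.
  Comparing the removal of \<open>A\<close> with that of \<open>B\<close> gives \<open>\<parallel>y\<parallel> \<le> \<parallel>z + (t + \<delta>) \<Sum>\<^sub>A \<epsilon>\<^sub>n e\<^sub>n\<parallel>\<close>, and
  \<open>\<delta> \<rightarrow> 0\<close> gives \<open>\<parallel>y\<parallel> \<le> \<parallel>x\<parallel>\<close>.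
\<close>

section \<open>Enumeration of a null sequence by decreasing size\<close>

text \<open>
  Larger values come first and ties are broken by the index; \<open>first_in f S\<close> picks out the least
  element of \<open>S\<close> for this order. For a nonnegative null sequence it is a well-order on the
  indices, which is what makes the greedy enumeration possible.
\<close>

definition first_in :: "(nat \<Rightarrow> real) \<Rightarrow> nat set \<Rightarrow> nat \<Rightarrow> bool" where
  "first_in f S n \<longleftrightarrow> n \<in> S \<and> (\<forall>k\<in>S. f k < f n \<or> f k = f n \<and> n \<le> k)"

lemma first_in_unique: "first_in f S m \<Longrightarrow> first_in f S n \<Longrightarrow> m = n"
  unfolding first_in_def by (metis antisym less_asym less_irrefl)

lemma finite_superlevel_of_null_sequence:
  fixes f :: "nat \<Rightarrow> real"
  assumes "f \<longlonglongrightarrow> 0" "0 < c"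
  shows "finite {n. c \<le> f n}"
proof -
  have "eventually (\<lambda>n. f n < c) sequentially"
    using assms by (rule order_tendstoD(2))
  then obtain N where "\<forall>n\<ge>N. f n < c"
    by (auto simp: eventually_sequentially)
  then have "{n. c \<le> f n} \<subseteq> {..<N}"
    by (auto simp: not_le[symmetric])
  then show ?thesis
    by (rule finite_subset) simp
qed

lemma first_in_exists:
  fixes f :: "nat \<Rightarrow> real"
  assumes lim: "f \<longlonglongrightarrow> 0" and nonneg: "\<And>n. 0 \<le> f n" and "S \<noteq> {}"
  shows "\<exists>n. first_in f S n"
proof -
  have "\<exists>m\<in>S. \<forall>k\<in>S. f k \<le> f m"
  proof (cases "\<exists>k\<in>S. 0 < f k")
    case True
    then obtain k0 where k0: "k0 \<in> S" "0 < f k0" by blast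
    let ?T = "{n\<in>S. f k0 \<le> f n}"
    have fin: "finite ?T"
      using finite_superlevel_of_null_sequence[OF lim k0(2)] by simp
    have "Max (f ` ?T) \<in> f ` ?T"
      using fin k0 by (intro Max_in) auto
    then obtain m where m: "m \<in> ?T" "f m = Max (f ` ?T)" by auto
    have "f k \<le> f m" if "k \<in> S" for k
    proof (cases "f k0 \<le> f k")
      case True
      then show ?thesis using fin that m by auto
    next
      case False
      then show ?thesis using m by auto
    qed
    then show ?thesis using m by blast
  next
    case False
    then have "f k \<le> f m" if "k \<in> S" for k m
      using that nonneg[of m] by force
    then show ?thesis using \<open>S \<noteq> {}\<close> by blast
  qed
  then obtain m where m: "m \<in> S" "\<forall>k\<in>S. f k \<le> f m" by blast
  define n where "n = (LEAST n. n \<in> S \<and> f n = f m)"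
  have n: "n \<in> S \<and> f n = f m"
    unfolding n_def by (rule LeastI[of _ m]) (simp add: m)
  have "n \<le> k" if "k \<in> S" "f k = f m" for k
    unfolding n_def using that by (intro Least_le) simp
  then have "first_in f S n"
    using m n by (force simp: first_in_def)
  then show ?thesis ..
qed

primrec greedy_set :: "(nat \<Rightarrow> real) \<Rightarrow> nat \<Rightarrow> nat set" where
  "greedy_set f 0 = {}"
| "greedy_set f (Suc i) = insert (SOME n. first_in f (- greedy_set f i) n) (greedy_set f i)"

lemma first_in_enumeration_exists:
  fixes f :: "nat \<Rightarrow> real"
  assumes lim: "f \<longlonglongrightarrow> 0" and nonneg: "\<And>n. 0 \<le> f n"
  shows "\<exists>\<rho> :: nat \<Rightarrow> nat. \<forall>i. first_in f (- \<rho> ` {..<i}) (\<rho> i)"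
proof -
  define \<rho> :: "nat \<Rightarrow> nat" where "\<rho> i = (SOME n. first_in f (- greedy_set f i) n)" for i
  have R: "greedy_set f i = \<rho> ` {..<i}" for i
    by (induction i) (simp_all add: lessThan_Suc \<rho>_def)
  have "first_in f (- \<rho> ` {..<i}) (\<rho> i)" for i
  proof -
    have "- \<rho> ` {..<i} \<noteq> {}"
      using ex_new_if_finite[OF infinite_UNIV_nat, of "\<rho> ` {..<i}"] by auto
    then have "\<exists>n. first_in f (- greedy_set f i) n"
      unfolding R by (rule first_in_exists[OF lim nonneg])
    then show ?thesis
      unfolding \<rho>_def[of i] R[symmetric] by (rule someI_ex)
  qed
  then show ?thesis by blast
qed

lemma first_in_enumeration_mono:
  fixes \<rho> :: "nat \<Rightarrow> nat"
  assumes "\<forall>i. first_in f (- \<rho> ` {..<i}) (\<rho> i)" "k \<notin> \<rho> ` {..<i}"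
  shows "f k < f (\<rho> i) \<or> f k = f (\<rho> i) \<and> \<rho> i \<le> k"
  using assms unfolding first_in_def by blast

lemma first_in_enumeration_inj:
  fixes \<rho> :: "nat \<Rightarrow> nat"
  assumes "\<forall>i. first_in f (- \<rho> ` {..<i}) (\<rho> i)"
  shows "inj \<rho>"
proof (rule linorder_injI)
  fix i j :: nat assume "i < j"
  moreover have "\<rho> j \<notin> \<rho> ` {..<j}"
    using assms by (auto simp: first_in_def)
  ultimately show "\<rho> i \<noteq> \<rho> j" by (metis imageI lessThan_iff)
qed

text \<open>
  The natural greedy orderings are exactly the enumerations that list at each stage the first
  remaining index. An index missed by such an enumeration would have infinitely many predecessors,
  which forces its value to be zero and infinitely many values to be positive; this reconciles the
  two prescribed ranges, everything or the support.
\<close>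

lemma is_natural_greedy_ordering_iff:
  fixes smul :: "'k::real_normed_field \<Rightarrow> 'a::real_normed_vector \<Rightarrow> 'a"
    and e :: "nat \<Rightarrow> 'a" and x :: 'a
  defines "f \<equiv> \<lambda>n. norm (coord smul e n x)"
  assumes lim: "f \<longlonglongrightarrow> 0"
  shows "is_natural_greedy_ordering smul e x \<rho> \<longleftrightarrow> (\<forall>i. first_in (f) (- \<rho> ` {..<i}) (\<rho> i))"
proof
  assume nat: "is_natural_greedy_ordering smul e x \<rho>"
  then have inj: "inj \<rho>" and dec: "\<And>i j. i \<le> j \<Longrightarrow> f (\<rho> j) \<le> f (\<rho> i)"
    and tie: "\<And>i j. i \<le> j \<Longrightarrow> f (\<rho> i) = f (\<rho> j) \<Longrightarrow> \<rho> i \<le> \<rho> j"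
    and sub: "supp smul e x \<subseteq> range \<rho>"
    and fin: "finite (supp smul e x) \<Longrightarrow> range \<rho> = UNIV"
    by (auto simp: is_natural_greedy_ordering_def greedy_ordering_def f_def)
  show "\<forall>i. first_in (f) (- \<rho> ` {..<i}) (\<rho> i)"
  proof
    fix i
    have "f k < f (\<rho> i) \<or> f k = f (\<rho> i) \<and> \<rho> i \<le> k" if k: "k \<notin> \<rho> ` {..<i}" for k
    proof (cases "k \<in> range \<rho>")
      case True
      then obtain j where j: "k = \<rho> j" by blast
      then have "i \<le> j" using k by (auto simp: not_less[symmetric])
      then show ?thesis using dec[of i j] tie[of i j] j by auto
    next
      case False
      then have k0: "f k = 0" using sub by (auto simp: f_def supp_def)
      have inf: "infinite (supp smul e x)" using fin False by auto
      have "f (\<rho> i) \<noteq> 0"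
      proof
        assume "f (\<rho> i) = 0"
        then have z: "f (\<rho> j) = 0" if "i \<le> j" for j
          using dec[OF that] by (simp add: f_def)
        have "supp smul e x \<subseteq> \<rho> ` {..<i}"
        proof
          fix n assume n: "n \<in> supp smul e x"
          then obtain j where "n = \<rho> j" using sub by blast
          then show "n \<in> \<rho> ` {..<i}"
            using n z[of j] by (cases "i \<le> j") (auto simp: f_def supp_def)
        qed
        then show False using inf finite_surj by blast
      qed
      then show ?thesis using k0 by (simp add: f_def)
    qed
    moreover have "\<rho> i \<notin> \<rho> ` {..<i}" using inj by (auto simp: inj_def)
    ultimately show "first_in (f) (- \<rho> ` {..<i}) (\<rho> i)" by (simp add: first_in_def)
  qed
next
  assume first: "\<forall>i. first_in (f) (- \<rho> ` {..<i}) (\<rho> i)"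
  note inj = first_in_enumeration_inj[OF first]
  note mono = first_in_enumeration_mono[OF first]
  have ord: "f (\<rho> j) < f (\<rho> i) \<or> f (\<rho> j) = f (\<rho> i) \<and> \<rho> i \<le> \<rho> j" if "i \<le> j" for i j
    using that by (intro mono) (auto dest: injD[OF inj])
  have inf: "infinite (range \<rho>)" using inj by (simp add: finite_image_iff)
  have sub: "supp smul e x \<subseteq> range \<rho>"
  proof (rule ccontr)
    assume "\<not> ?thesis"
    then obtain k where k: "k \<in> supp smul e x" "k \<notin> range \<rho>" by blast
    have "f k \<le> f (\<rho> i)" for i
    proof -
      have "k \<notin> \<rho> ` {..<i}" using k(2) by blast
      from mono[OF this] show ?thesis by linarith
    qed
    then have "range \<rho> \<subseteq> {n. f k \<le> f n}" by blast
    moreover have "finite {n. f k \<le> f n}"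
      using k(1) by (intro finite_superlevel_of_null_sequence[OF lim]) (simp add: f_def supp_def)
    ultimately show False using inf finite_subset by blast
  qed
  have "range \<rho> = UNIV" if fin: "finite (supp smul e x)"
  proof (rule ccontr)
    assume "\<not> ?thesis"
    then obtain k where k: "k \<notin> range \<rho>" by blast
    then have "f k = 0" using sub by (auto simp: f_def supp_def)
    then have "\<rho> i \<in> supp smul e x \<union> {..k}" for i
      using mono[of k i] k by (auto simp: f_def supp_def)
    then have "range \<rho> \<subseteq> supp smul e x \<union> {..k}" by blast
    then show False using inf fin finite_subset by blast
  qed
  moreover have "f (\<rho> j) \<le> f (\<rho> i)" "f (\<rho> i) = f (\<rho> j) \<Longrightarrow> \<rho> i \<le> \<rho> j" if "i \<le> j" for i j
    using ord[OF that] by auto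
  ultimately show "is_natural_greedy_ordering smul e x \<rho>"
    using inj sub by (auto simp: is_natural_greedy_ordering_def greedy_ordering_def f_def)
qed

lemma natural_greedy_ordering_is_natural:
  fixes smul :: "'k::real_normed_field \<Rightarrow> 'a::real_normed_vector \<Rightarrow> 'a"
  assumes lim: "(\<lambda>n. norm (coord smul e n x)) \<longlonglongrightarrow> 0"
  shows "is_natural_greedy_ordering smul e x (natural_greedy_ordering smul e x)"
  unfolding natural_greedy_ordering_def
proof (rule theI'[of "is_natural_greedy_ordering smul e x"])
  let ?f = "\<lambda>n. norm (coord smul e n x)"
  note iff = is_natural_greedy_ordering_iff[OF lim]
  obtain \<rho> :: "nat \<Rightarrow> nat" where \<rho>: "\<forall>i. first_in ?f (- \<rho> ` {..<i}) (\<rho> i)"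
    using first_in_enumeration_exists[OF lim norm_ge_zero] by blast
  show "\<exists>!\<rho>. is_natural_greedy_ordering smul e x \<rho>"
  proof (rule ex1I[of _ \<rho>])
    show "is_natural_greedy_ordering smul e x \<rho>"
      using \<rho> by (simp add: iff)
    fix \<sigma> assume "is_natural_greedy_ordering smul e x \<sigma>"
    then have \<sigma>: "\<forall>i. first_in ?f (- \<sigma> ` {..<i}) (\<sigma> i)"
      by (simp add: iff)
    have "\<sigma> i = \<rho> i" for i
    proof (induction i rule: less_induct)
      case (less i)
      then have "\<sigma> ` {..<i} = \<rho> ` {..<i}" by auto
      then show ?case using \<rho> \<sigma> first_in_unique by metis
    qed
    then show "\<sigma> = \<rho>" by blast
  qed
qed

lemma greedy_approx_eq_coord_proj:
  fixes smul :: "'k::real_normed_field \<Rightarrow> 'a::real_normed_vector \<Rightarrow> 'a"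
  assumes lim: "(\<lambda>n. norm (coord smul e n x)) \<longlonglongrightarrow> 0"
  obtains G where "finite G" "card G = m"
    "\<And>n k. n \<in> G \<Longrightarrow> k \<notin> G \<Longrightarrow> norm (coord smul e k x) \<le> norm (coord smul e n x)"
    "greedy_approx smul e m x = coord_proj smul e G x"
proof
  let ?\<rho> = "natural_greedy_ordering smul e x"
  have first: "\<forall>i. first_in (\<lambda>n. norm (coord smul e n x)) (- ?\<rho> ` {..<i}) (?\<rho> i)"
    using natural_greedy_ordering_is_natural[OF lim] is_natural_greedy_ordering_iff[OF lim] by blast
  have inj: "inj_on ?\<rho> {..<m}"
    using first_in_enumeration_inj[OF first] by (rule inj_on_subset) simp
  show "finite (?\<rho> ` {..<m})" by simp
  show "card (?\<rho> ` {..<m}) = m" using inj by (simp add: card_image)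
  show "greedy_approx smul e m x = coord_proj smul e (?\<rho> ` {..<m}) x"
    unfolding greedy_approx_def coord_proj_def using inj by (simp add: sum.reindex)
  show "norm (coord smul e k x) \<le> norm (coord smul e n x)"
    if "n \<in> ?\<rho> ` {..<m}" "k \<notin> ?\<rho> ` {..<m}" for n k
  proof -
    obtain i where i: "n = ?\<rho> i" "i < m" using \<open>n \<in> _\<close> by blast
    then have "k \<notin> ?\<rho> ` {..<i}" using \<open>k \<notin> _\<close> by auto
    then show ?thesis using first_in_enumeration_mono[OF first, of k i] i by auto
  qed
qed

section \<open>Coordinates with respect to a Schauder basis\<close>

locale normed_schauder_basis = normed_vector_space smul
  for smul :: "'k::{real_normed_field,banach} \<Rightarrow> 'a::real_normed_vector \<Rightarrow> 'a" +
  fixes e :: "nat \<Rightarrow> 'a"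
  assumes basis: "schauder_basis smul e"
begin

abbreviation lincomb :: "nat set \<Rightarrow> (nat \<Rightarrow> 'k) \<Rightarrow> 'a" where
  "lincomb A c \<equiv> (\<Sum>n\<in>A. smul (c n) (e n))"

lemma coord_unique:
  assumes "(\<lambda>n. smul (a n) (e n)) sums x"
  shows "coord smul e n x = a n"
proof -
  have "(THE a. (\<lambda>n. smul (a n) (e n)) sums x) = a"
    using basis assms unfolding schauder_basis_def by (intro the1_equality) blast+
  then show ?thesis by (simp add: coord_def)
qed

lemma coord_sums: "(\<lambda>n. smul (coord smul e n x) (e n)) sums x"
proof -
  obtain a where a: "(\<lambda>n. smul (a n) (e n)) sums x"
    using basis unfolding schauder_basis_def by blast
  then show ?thesis by (simp add: coord_unique[OF a])
qed

lemma coord_add_lincomb: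
  assumes "finite A"
  shows "coord smul e n (x + lincomb A c) = coord smul e n x + (if n \<in> A then c n else 0)"
proof (rule coord_unique)
  have "(\<lambda>n. if n \<in> A then smul (c n) (e n) else 0) sums lincomb A c"
    using assms by (rule sums_If_finite_set)
  from sums_add[OF coord_sums[of x] this]
  show "(\<lambda>n. smul (coord smul e n x + (if n \<in> A then c n else 0)) (e n)) sums (x + lincomb A c)"
    by (rule sums_cong[THEN iffD1, rotated]) (simp add: scale_left_distrib)
qed

lemma coord_lincomb:
  assumes "finite A"
  shows "coord smul e n (lincomb A c) = (if n \<in> A then c n else 0)"
proof -
  have "coord smul e n 0 = 0" by (rule coord_unique) simp
  then show ?thesis using coord_add_lincomb[OF assms, of n 0 c] by simp
qed

lemma coord_tendsto_zero:
  assumes "semi_normalized e"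
  shows "(\<lambda>n. norm (coord smul e n x)) \<longlonglongrightarrow> 0"
proof -
  define \<delta> where "\<delta> = (INF n. norm (e n))"
  have pos: "0 < \<delta>" using assms by (simp add: semi_normalized_def \<delta>_def)
  have le: "\<delta> \<le> norm (e n)" for n
    unfolding \<delta>_def by (rule cINF_lower) (auto intro!: bdd_belowI[of _ 0])
  have "(\<lambda>n. smul (coord smul e n x) (e n)) \<longlonglongrightarrow> 0"
    using coord_sums[of x] by (intro summable_LIMSEQ_zero) (rule sums_summable)
  then have "(\<lambda>n. norm (smul (coord smul e n x) (e n)) / \<delta>) \<longlonglongrightarrow> 0"
    using tendsto_divide[OF tendsto_norm_zero tendsto_const, of _ _ \<delta>] pos by fastforce
  moreover have "norm (norm (coord smul e n x)) \<le> norm (smul (coord smul e n x) (e n)) / \<delta>" for n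
    using mult_left_mono[OF le[of n], of "norm (coord smul e n x)"] pos
    by (simp add: norm_scale pos_le_divide_eq)
  ultimately show ?thesis
    by (intro Lim_null_comparison[of "\<lambda>n. norm (coord smul e n x)"]) (auto intro: always_eventually)
qed

lemma smul_lincomb: "smul r (lincomb A c) = lincomb A (\<lambda>n. r * c n)"
  by (simp add: scale_sum_right)

section \<open>Blocks of coefficients: convexity and Property (A)\<close>

text \<open>
  A coefficient of modulus at most \<open>t\<close> is \<open>r t s\<close> with \<open>\<bar>r\<bar> \<le> 1\<close> and \<open>\<parallel>s\<parallel> = 1\<close>, hence a convex
  combination of \<open>t s\<close> and \<open>- t s\<close>. Replacing the coefficients one at a time by these two extremes
  only needs convexity of the ball of radius \<open>M\<close>, for real and for complex scalars alike.
\<close>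

lemma norm_block_le_of_extreme_blocks:
  assumes "finite D" "0 \<le> t" "\<And>n. n \<in> D \<Longrightarrow> norm (a n) \<le> t"
    and "\<And>\<epsilon>. (\<And>n. norm (\<epsilon> n) = 1) \<Longrightarrow> norm (v + lincomb D (\<lambda>n. of_real t * \<epsilon> n)) \<le> M"
  shows "norm (v + lincomb D a) \<le> M"
  using assms
proof (induction D arbitrary: v rule: finite_induct)
  case empty
  from empty.prems(3)[of "\<lambda>_. 1"] show ?case by simp
next
  case (insert d D)
  obtain s r where s: "norm s = 1" and r: "\<bar>r\<bar> \<le> 1" and a: "a d = of_real (r * t) * s"
  proof (cases "a d = 0")
    case True
    then show ?thesis by (intro that[of 1 0]) auto
  next
    case False
    then have t: "0 < t"
      using insert.prems(2)[of d] by (metis insertI1 order_less_le_trans zero_less_norm_iff)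
    show ?thesis
    proof (rule that[of "sgn (a d)" "norm (a d) / t"])
      show "norm (sgn (a d)) = 1" using False by (simp add: norm_sgn)
      show "\<bar>norm (a d) / t\<bar> \<le> 1" using insert.prems(2)[of d] t by simp
      show "a d = of_real (norm (a d) / t * t) * sgn (a d)"
        using t False by (simp add: sgn_div_norm scaleR_conv_of_real)
    qed
  qed
  have extreme: "norm (v + smul (of_real t * s') (e d) + lincomb D a) \<le> M" if s': "norm s' = 1" for s'
  proof (rule insert.IH)
    show "0 \<le> t" by fact
    show "norm (a n) \<le> t" if "n \<in> D" for n using insert.prems(2) that by simp
    fix \<epsilon> :: "nat \<Rightarrow> 'k" assume \<epsilon>: "\<And>n. norm (\<epsilon> n) = 1"
    have "norm (v + lincomb (insert d D) (\<lambda>n. of_real t * (\<epsilon>(d := s')) n)) \<le> M"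
      using \<epsilon> s' by (intro insert.prems(3)) auto
    moreover have "lincomb (insert d D) (\<lambda>n. of_real t * (\<epsilon>(d := s')) n)
        = smul (of_real t * s') (e d) + lincomb D (\<lambda>n. of_real t * \<epsilon> n)"
      using insert.hyps by (auto intro!: sum.cong)
    ultimately show "norm (v + smul (of_real t * s') (e d) + lincomb D (\<lambda>n. of_real t * \<epsilon> n)) \<le> M"
      by (simp add: add.assoc)
  qed
  let ?p = "v + smul (of_real t * s) (e d) + lincomb D a"
  let ?q = "v + smul (of_real t * - s) (e d) + lincomb D a"
  have "smul (a d) (e d) = r *\<^sub>R smul (of_real t * s) (e d)"
    unfolding a scale_of_real[symmetric] by (simp add: mult.assoc)
  then have "v + lincomb (insert d D) a = ((1 + r) / 2) *\<^sub>R ?p + ((1 - r) / 2) *\<^sub>R ?q"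
    using insert.hyps by (simp add: algebra_simps flip: scaleR_add_left) (simp add: field_simps flip: scaleR_add_left)
  also have "norm \<dots> \<le> ((1 + r) / 2) * M + ((1 - r) / 2) * M"
    using extreme[of s] extreme[of "- s"] s r
    by (intro norm_triangle_le add_mono) (auto intro!: mult_left_mono)
  also have "\<dots> = M" by (simp add: field_simps)
  finally show ?case .
qed

lemma property_A_exchange:
  assumes "property_A smul e" "finite F" "finite A" "finite B"
    and "F \<inter> A = {}" "F \<inter> B = {}" "A \<inter> B = {}" "card A = card B"
    and "0 \<le> t" "\<And>n. n \<in> F \<Longrightarrow> norm (c n) \<le> t"
    and "\<And>n. norm (\<epsilon> n) = 1" "\<And>n. norm (\<theta> n) = 1"
  shows "norm (lincomb F c + lincomb A (\<lambda>n. of_real t * \<epsilon> n))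
       = norm (lincomb F c + lincomb B (\<lambda>n. of_real t * \<theta> n))"
proof -
  have "disjoint_greedy_permutation smul e
      (lincomb F c + smul (of_real t) (lincomb A \<epsilon>)) (lincomb F c + smul (of_real t) (lincomb B \<theta>))"
    unfolding disjoint_greedy_permutation_def
    using assms
    by (intro exI[of _ "lincomb F c"] exI[of _ A] exI[of _ B] exI[of _ \<epsilon>] exI[of _ \<theta>] exI[of _ t])
       (auto simp: supp_def coord_lincomb)
  then show ?thesis
    using assms(1) by (simp add: property_A_def smul_lincomb)
qed

text \<open>
  Property (A) exchanges disjoint blocks only, so the block makes a detour over a set disjoint from
  both \<open>A\<close> and the background \<open>F\<close>. Such a set exists because \<open>F\<close> is finite.
\<close>

lemma property_A_change_signs:
  assumes "property_A smul e" "finite F" "finite A" "F \<inter> A = {}"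
    and "0 \<le> t" "\<And>n. n \<in> F \<Longrightarrow> norm (c n) \<le> t"
    and "\<And>n. norm (\<epsilon> n) = 1" "\<And>n. norm (\<theta> n) = 1"
  shows "norm (lincomb F c + lincomb A (\<lambda>n. of_real t * \<epsilon> n))
       = norm (lincomb F c + lincomb A (\<lambda>n. of_real t * \<theta> n))"
proof -
  have "infinite (- (F \<union> A))"
    using assms by (simp add: Compl_eq_Diff_UNIV)
  then obtain B where B: "B \<subseteq> - (F \<union> A)" "card B = card A" "finite B"
    using infinite_arbitrarily_large by blast
  have "norm (lincomb F c + lincomb A (\<lambda>n. of_real t * \<epsilon> n))
      = norm (lincomb F c + lincomb B (\<lambda>n. of_real t * 1))"
    using assms B by (intro property_A_exchange) auto
  also have "\<dots> = norm (lincomb F c + lincomb A (\<lambda>n. of_real t * \<theta> n))"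
    using assms B by (intro property_A_exchange) auto
  finally show ?thesis .
qed

lemma norm_small_block_le_flat_block:
  assumes "property_A smul e" "finite F" "finite D" "F \<inter> D = {}"
    and "0 \<le> t" "\<And>n. n \<in> F \<Longrightarrow> norm (c n) \<le> t" "\<And>n. n \<in> D \<Longrightarrow> norm (a n) \<le> t"
    and "\<And>n. norm (\<epsilon> n) = 1"
  shows "norm (lincomb F c + lincomb D a) \<le> norm (lincomb F c + lincomb D (\<lambda>n. of_real t * \<epsilon> n))"
proof (rule norm_block_le_of_extreme_blocks[where t = t])
  fix \<theta> :: "nat \<Rightarrow> 'k" assume "\<And>n. norm (\<theta> n) = 1"
  then show "norm (lincomb F c + lincomb D (\<lambda>n. of_real t * \<theta> n))
      \<le> norm (lincomb F c + lincomb D (\<lambda>n. of_real t * \<epsilon> n))"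
    using assms by (intro eq_refl[OF property_A_change_signs]) auto
qed (use assms in auto)

text \<open>
  Induction on the size of \<open>E\<close>: raise the height to the least target value \<open>t'\<close>. An index \<open>n0\<close>
  attaining it now carries its target coefficient, and it can join the background \<open>F\<close>, whose
  coefficients stay bounded by the new height.
\<close>

lemma norm_flat_block_le_large_block:
  assumes A: "property_A smul e" and "finite E" "finite F" "F \<inter> E = {}"
    and "0 \<le> t" "\<And>n. n \<in> F \<Longrightarrow> norm (c n) \<le> t" "\<And>n. n \<in> E \<Longrightarrow> t \<le> h n"
    and \<epsilon>: "\<And>n. norm (\<epsilon> n) = 1"
  shows "norm (lincomb F c + lincomb E (\<lambda>n. of_real t * \<epsilon> n))
       \<le> norm (lincomb F c + lincomb E (\<lambda>n. of_real (h n) * \<epsilon> n))"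
  using assms(2-7)
proof (induction "card E" arbitrary: E F c t)
  case 0
  then show ?case by simp
next
  case (Suc k)
  define t' where "t' = Min (h ` E)"
  have "E \<noteq> {}" using Suc.hyps(2) by auto
  then have "t' \<in> h ` E" unfolding t'_def using Suc.prems by (intro Min_in) auto
  then obtain n0 where n0: "n0 \<in> E" "h n0 = t'" by auto
  have t': "t' \<le> h n" if "n \<in> E" for n
    using that Suc.prems by (simp add: t'_def)
  have tt': "t \<le> t'" using n0 Suc.prems(6) by auto
  have n0F: "n0 \<notin> F" using n0 Suc.prems by auto
  define c' where "c' = c(n0 := of_real t' * \<epsilon> n0)"
  have join: "lincomb F c + lincomb E (\<lambda>n. of_real (g n) * \<epsilon> n)
      = lincomb (insert n0 F) c' + lincomb (E - {n0}) (\<lambda>n. of_real (g n) * \<epsilon> n)"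
    if "g n0 = t'" for g
  proof -
    have "lincomb (insert n0 F) c' = smul (of_real t' * \<epsilon> n0) (e n0) + lincomb F c"
      using Suc.prems n0F by (auto simp: c'_def intro!: sum.cong)
    moreover have "lincomb E (\<lambda>n. of_real (g n) * \<epsilon> n)
        = smul (of_real (g n0) * \<epsilon> n0) (e n0) + lincomb (E - {n0}) (\<lambda>n. of_real (g n) * \<epsilon> n)"
      using Suc.prems n0 by (simp add: sum.remove[of E n0])
    ultimately show ?thesis using that by (simp add: algebra_simps)
  qed
  have "norm (lincomb F c + lincomb E (\<lambda>n. of_real t * \<epsilon> n))
      \<le> norm (lincomb F c + lincomb E (\<lambda>n. of_real t' * \<epsilon> n))"
    using Suc.prems tt' \<epsilon>
    by (intro norm_small_block_le_flat_block[OF A]) (auto simp: norm_mult intro: order_trans)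
  also have "\<dots> = norm (lincomb (insert n0 F) c' + lincomb (E - {n0}) (\<lambda>n. of_real t' * \<epsilon> n))"
    by (subst join[of "\<lambda>_. t'"]) simp_all
  also have "\<dots> \<le> norm (lincomb (insert n0 F) c' + lincomb (E - {n0}) (\<lambda>n. of_real (h n) * \<epsilon> n))"
  proof (rule Suc.hyps(1))
    show "k = card (E - {n0})" using Suc.hyps(2) Suc.prems n0 by simp
    show "norm (c' n) \<le> t'" if "n \<in> insert n0 F" for n
      using that Suc.prems(4) Suc.prems(5)[of n] tt' \<epsilon> by (auto simp: c'_def norm_mult)
  qed (use Suc.prems tt' t' in auto)
  also have "\<dots> = norm (lincomb F c + lincomb E (\<lambda>n. of_real (h n) * \<epsilon> n))"
    by (subst join) (simp_all add: n0)
  finally show ?case .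
qed

lemma property_A_small_block_le_large_block:
  assumes A: "property_A smul e" and fin: "finite F" "finite D" "finite E"
    and disj: "F \<inter> D = {}" "F \<inter> E = {}" "D \<inter> E = {}" and card: "card D = card E"
    and t: "0 \<le> t" and c: "\<And>n. n \<in> F \<Longrightarrow> norm (c n) \<le> t"
    and a: "\<And>n. n \<in> D \<Longrightarrow> norm (a n) \<le> t" and b: "\<And>n. n \<in> E \<Longrightarrow> t \<le> norm (b n)"
  shows "norm (lincomb F c + lincomb D a) \<le> norm (lincomb F c + lincomb E b)"
proof -
  define \<epsilon> where "\<epsilon> n = (if b n = 0 then 1 else sgn (b n))" for n
  have \<epsilon>: "norm (\<epsilon> n) = 1" for n by (simp add: \<epsilon>_def norm_sgn)
  have b_eq: "of_real (norm (b n)) * \<epsilon> n = b n" for n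
    by (simp add: \<epsilon>_def sgn_div_norm scaleR_conv_of_real)
  have "norm (lincomb F c + lincomb D a) \<le> norm (lincomb F c + lincomb D (\<lambda>n. of_real t * \<epsilon> n))"
    using fin disj t c a \<epsilon> by (intro norm_small_block_le_flat_block[OF A])
  also have "\<dots> = norm (lincomb F c + lincomb E (\<lambda>n. of_real t * \<epsilon> n))"
    using fin disj card t c \<epsilon> by (intro property_A_exchange[OF A])
  also have "\<dots> \<le> norm (lincomb F c + lincomb E (\<lambda>n. of_real (norm (b n)) * \<epsilon> n))"
    using fin disj t c b \<epsilon> by (intro norm_flat_block_le_large_block[OF A])
  finally show ?thesis by (simp add: b_eq)
qed

section \<open>The equivalence\<close>

text \<open>
  The two residuals have the common part \<open>w = x - P\<^bsub>G \<union> H\<^esub> x\<close>, and differ by the block on \<open>H - G\<close>,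
  with coefficients at most \<open>t = min {|x\<^sub>n|. n \<in> G}\<close>, versus the block on \<open>G - H\<close>, with coefficients
  at least \<open>t\<close>. The comparison is made with \<open>w\<close> cut off at \<open>N\<close> and passes to the limit.
\<close>

lemma property_A_greedy_removal_optimal:
  assumes A: "property_A smul e" and fin: "finite G" "finite H" and card: "card G = card H" "G \<noteq> {}"
    and dom: "\<And>n k. n \<in> G \<Longrightarrow> k \<notin> G \<Longrightarrow> norm (coord smul e k x) \<le> norm (coord smul e n x)"
  shows "norm (x - coord_proj smul e G x) \<le> norm (x - coord_proj smul e H x)"
proof -
  let ?c = "\<lambda>n. coord smul e n x"
  define t where "t = Min ((\<lambda>n. norm (?c n)) ` G)"
  have "t \<in> (\<lambda>n. norm (?c n)) ` G" unfolding t_def using fin card by (intro Min_in) auto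
  then obtain n0 where n0: "n0 \<in> G" "t = norm (?c n0)" by auto
  have large: "t \<le> norm (?c n)" if "n \<in> G" for n using that fin by (simp add: t_def)
  have small: "norm (?c n) \<le> t" if "n \<notin> G" for n using dom n0 that by simp
  let ?F = "\<lambda>N. {..<N} - (G \<union> H)"
  have cards: "card (H - G) = card (G - H)"
    using fin card by (metis card_le_sym_Diff dual_order.eq_iff order_refl)
  have le: "norm (lincomb (?F N) ?c + lincomb (H - G) ?c) \<le> norm (lincomb (?F N) ?c + lincomb (G - H) ?c)" for N
  proof (rule property_A_small_block_le_large_block[OF A])
    show "0 \<le> t" using n0 by simp
  qed (use fin cards in \<open>auto intro: large small\<close>)
  have lim: "(\<lambda>N. lincomb (?F N) ?c + lincomb (K - L) ?c) \<longlonglongrightarrow> x - coord_proj smul e L x"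
    if KL: "K \<union> L = G \<union> H" for K L
  proof -
    have finKL: "finite (K \<union> L)" using KL fin by simp
    have "lincomb {..<N} ?c - lincomb L ?c = lincomb (?F N) ?c + lincomb (K - L) ?c"
      if N: "K \<union> L \<subseteq> {..<N}" for N
    proof -
      have "lincomb {..<N} ?c = lincomb (?F N) ?c + lincomb (K \<union> L) ?c"
        unfolding KL[symmetric] using N by (intro sum.subset_diff) auto
      also have "lincomb (K \<union> L) ?c = lincomb (K - L) ?c + lincomb L ?c"
        using sum.subset_diff[of L "K \<union> L"] finKL by (simp add: Un_Diff)
      finally show ?thesis by simp
    qed
    moreover have "eventually (\<lambda>N. K \<union> L \<subseteq> {..<N}) sequentially"
    proof -
      obtain M where "K \<union> L \<subseteq> {..<M}"
        using finKL finite_nat_iff_bounded by blast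
      then show ?thesis
        by (intro eventually_sequentiallyI[of M]) (meson lessThan_subset_iff order_trans)
    qed
    ultimately have "eventually (\<lambda>N. lincomb {..<N} ?c - lincomb L ?c
        = lincomb (?F N) ?c + lincomb (K - L) ?c) sequentially"
      by (auto elim: eventually_mono)
    moreover have "(\<lambda>N. lincomb {..<N} ?c - lincomb L ?c) \<longlonglongrightarrow> x - lincomb L ?c"
      using coord_sums[of x] by (auto simp: sums_def intro: tendsto_intros)
    ultimately show ?thesis
      by (auto simp: coord_proj_def intro: Lim_transform_eventually)
  qed
  show ?thesis
    using tendsto_norm[OF lim[of H G]] tendsto_norm[OF lim[of G H]] le
    by (intro LIMSEQ_le) auto
qed

lemma almost_greedy_if_property_A:
  assumes "semi_normalized e" and A: "property_A smul e"
  shows "almost_greedy smul e 1"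
  unfolding almost_greedy_def
proof (intro allI impI)
  fix x and m :: nat assume m: "1 \<le> m"
  obtain G where G: "finite G" "card G = m"
    "\<And>n k. n \<in> G \<Longrightarrow> k \<notin> G \<Longrightarrow> norm (coord smul e k x) \<le> norm (coord smul e n x)"
    "greedy_approx smul e m x = coord_proj smul e G x"
    using greedy_approx_eq_coord_proj[OF coord_tendsto_zero[OF assms(1)]] by metis
  have "norm (x - coord_proj smul e G x) \<le> Inf {norm (x - coord_proj smul e H x) | H. finite H \<and> card H = m}"
  proof (rule cInf_greatest)
    show "{norm (x - coord_proj smul e H x) | H. finite H \<and> card H = m} \<noteq> {}"
      using G by blast
    fix r assume "r \<in> {norm (x - coord_proj smul e H x) | H. finite H \<and> card H = m}"
    then obtain H where "r = norm (x - coord_proj smul e H x)" "finite H" "card H = m" by blast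
    moreover have "G \<noteq> {}" using G(2) m by auto
    ultimately show "norm (x - coord_proj smul e G x) \<le> r"
      using property_A_greedy_removal_optimal[OF A G(1) _ _ _ G(3)] G(2) by auto
  qed
  then show "norm (x - greedy_approx smul e m x)
      \<le> 1 * Inf {norm (x - coord_proj smul e H x) | H. finite H \<and> card H = m}"
    using G(4) by simp
qed

text \<open>
  Under strict domination \<open>A\<close> is the only greedy set of its size, hence the one that the natural
  greedy ordering lists first.
\<close>

lemma almost_greedy_strictly_dominant_removal:
  assumes "semi_normalized e" and AG: "almost_greedy smul e 1"
    and fin: "finite A" "finite B" and card: "card A = card B" "A \<noteq> {}"
    and dom: "\<And>n k. n \<in> A \<Longrightarrow> k \<notin> A \<Longrightarrow> norm (coord smul e k u) < norm (coord smul e n u)"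
  shows "norm (u - coord_proj smul e A u) \<le> norm (u - coord_proj smul e B u)"
proof -
  obtain G where G: "finite G" "card G = card A"
    "\<And>n k. n \<in> G \<Longrightarrow> k \<notin> G \<Longrightarrow> norm (coord smul e k u) \<le> norm (coord smul e n u)"
    "greedy_approx smul e (card A) u = coord_proj smul e G u"
    using greedy_approx_eq_coord_proj[OF coord_tendsto_zero[OF assms(1)]] by metis
  have "A \<subseteq> G"
  proof (rule ccontr)
    assume "\<not> A \<subseteq> G"
    then obtain n where n: "n \<in> A" "n \<notin> G" by blast
    then have "\<not> G \<subseteq> A" using card_subset_eq[of A G] fin G by auto
    then obtain k where "k \<in> G" "k \<notin> A" by blast
    then show False using dom[of n k] G(3)[of k n] n by simp
  qed
  then have [simp]: "G = A" using card_subset_eq[of G A] G by simp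
  have "1 \<le> card A" using fin(1) card(2) by (simp add: Suc_le_eq card_gt_0_iff)
  then have "norm (u - greedy_approx smul e (card A) u)
      \<le> 1 * Inf {norm (u - coord_proj smul e H u) | H. finite H \<and> card H = card A}"
    using AG unfolding almost_greedy_def by blast
  also have "\<dots> \<le> norm (u - coord_proj smul e B u)"
    unfolding mult_1 by (rule cInf_lower) (use fin card in \<open>auto intro!: bdd_belowI[of _ 0]\<close>)
  finally show ?thesis using G(4) by simp
qed

text \<open>
  At equal heights both \<open>A\<close> and \<open>B\<close> are greedy sets. Raising the block on \<open>A\<close> by \<open>\<delta>\<close> singles out
  \<open>A\<close>, and \<open>B\<close> is then the competitor whose removal leaves the raised block.
\<close>

lemma almost_greedy_norm_le_of_exchange:
  assumes "semi_normalized e" "almost_greedy smul e 1"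
    and fin: "finite A" "finite B" and disj: "A \<inter> B = {}" and card: "card A = card B"
    and supp: "supp smul e z \<inter> (A \<union> B) = {}"
    and \<epsilon>: "\<And>n. n \<in> A \<Longrightarrow> norm (\<epsilon> n) = 1" and \<theta>: "\<And>n. n \<in> B \<Longrightarrow> norm (\<theta> n) = 1"
    and t: "\<And>n. norm (coord smul e n z) \<le> t"
  shows "norm (z + smul (of_real t) (lincomb B \<theta>)) \<le> norm (z + smul (of_real t) (lincomb A \<epsilon>))"
proof (cases "A = {}")
  case True
  then show ?thesis using fin card by auto
next
  case False
  have t0: "0 \<le> t" using t[of 0] norm_ge_zero order_trans by blast
  have z0: "coord smul e n z = 0" if "n \<in> A \<union> B" for n
    using supp that by (auto simp: supp_def)
  have "norm (z + smul (of_real t) (lincomb B \<theta>)) \<le> norm (z + smul (of_real (t + \<delta>)) (lincomb A \<epsilon>))"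
    if \<delta>: "0 < \<delta>" for \<delta>
  proof -
    define u where "u = z + lincomb A (\<lambda>n. of_real (t + \<delta>) * \<epsilon> n) + lincomb B (\<lambda>n. of_real t * \<theta> n)"
    have u: "coord smul e n u = coord smul e n z + (if n \<in> A then of_real (t + \<delta>) * \<epsilon> n else 0)
        + (if n \<in> B then of_real t * \<theta> n else 0)" for n
      by (simp only: u_def coord_add_lincomb fin)
    have uA: "coord smul e n u = of_real (t + \<delta>) * \<epsilon> n" if "n \<in> A" for n
      using that disj z0 by (auto simp: u)
    have uB: "coord smul e n u = of_real t * \<theta> n" if "n \<in> B" for n
      using that disj z0 by (auto simp: u)
    have "norm (coord smul e k u) < norm (coord smul e n u)" if "n \<in> A" "k \<notin> A" for n k
    proof -
      have "norm (coord smul e k u) \<le> t"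
      proof (cases "k \<in> B")
        case True
        then show ?thesis using \<theta> t0 by (simp add: uB norm_mult)
      next
        case False
        then show ?thesis using t \<open>k \<notin> A\<close> by (simp add: u)
      qed
      also have "t < norm (coord smul e n u)"
        using that \<epsilon> \<delta> t0 by (simp add: uA norm_mult del: of_real_add)
      finally show ?thesis .
    qed
    then have "norm (u - coord_proj smul e A u) \<le> norm (u - coord_proj smul e B u)"
      using False by (intro almost_greedy_strictly_dominant_removal[OF assms(1,2) fin card])
    moreover have "coord_proj smul e A u = lincomb A (\<lambda>n. of_real (t + \<delta>) * \<epsilon> n)"
      unfolding coord_proj_def by (rule sum.cong) (simp_all only: uA)
    moreover have "coord_proj smul e B u = lincomb B (\<lambda>n. of_real t * \<theta> n)"
      unfolding coord_proj_def by (rule sum.cong) (simp_all only: uB)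
    ultimately show ?thesis
      unfolding smul_lincomb by (simp add: u_def)
  qed
  then have ev: "eventually (\<lambda>\<delta>. norm (z + smul (of_real t) (lincomb B \<theta>))
      \<le> norm (z + (t + \<delta>) *\<^sub>R lincomb A \<epsilon>)) (at_right 0)"
    by (auto simp: scale_of_real eventually_at_right_field simp del: of_real_add intro!: exI[of _ 1])
  have "((\<lambda>\<delta>. norm (z + (t + \<delta>) *\<^sub>R lincomb A \<epsilon>)) \<longlongrightarrow> norm (z + (t + 0) *\<^sub>R lincomb A \<epsilon>)) (at_right 0)"
    by (intro tendsto_intros)
  from tendsto_lowerbound[OF this ev] show ?thesis
    by (simp add: scale_of_real)
qed

lemma property_A_if_almost_greedy:
  assumes "semi_normalized e" "almost_greedy smul e 1"
  shows "property_A smul e"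
  unfolding property_A_def disjoint_greedy_permutation_def
proof (intro allI impI, elim exE conjE)
  fix x y z A B \<epsilon> \<theta> t
  assume *: "finite A" "finite B" "A \<inter> B = {}" "card A = card B" "supp smul e z \<inter> (A \<union> B) = {}"
    "\<forall>n\<in>A. norm (\<epsilon> n) = 1" "\<forall>n\<in>B. norm (\<theta> n) = 1" "\<forall>n. norm (coord smul e n z) \<le> t"
    and xy: "x = z + smul (of_real t) (lincomb A \<epsilon>)" "y = z + smul (of_real t) (lincomb B \<theta>)"
  have "norm y \<le> norm x"
    unfolding xy using * by (intro almost_greedy_norm_le_of_exchange[OF assms]) auto
  moreover have "norm x \<le> norm y"
    unfolding xy using * by (intro almost_greedy_norm_le_of_exchange[OF assms]) auto
  ultimately show "norm x = norm y" by simp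
qed

end

theorem theorem1p5:
  fixes smul :: "'k::{real_normed_field,banach} \<Rightarrow> 'a::banach \<Rightarrow> 'a"
    and e :: "nat \<Rightarrow> 'a"
  assumes "normed_vector_space smul"
    and "infinite_dimensional smul"
    and "separable_space (euclidean :: 'a topology)"
    and "schauder_basis smul e"
    and "semi_normalized e"
  shows "almost_greedy smul e 1 \<longleftrightarrow> property_A smul e"
proof -
  interpret normed_schauder_basis smul e
    using assms by (simp add: normed_schauder_basis_def normed_schauder_basis_axioms_def)
  show ?thesis
    using almost_greedy_if_property_A property_A_if_almost_greedy assms(5) by blast
qed

end
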